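(* Let $\ell\ge2$ be an integer and suppose that $\tau:\mathbb{R}/\mathbb{Z}\to\mathbb{R}$ is Lipschitz. Then there exists a Lipschitz map $\mu:\mathbb{R}/\mathbb{Z}\to\mathbb{R}$ satisfying the following properties: (1) $\mathcal{J}_\mu=\emptyset$, and for all $\lambda\in(0,1)\setminus\mathcal{J}_\tau$ the maps $A_{\lambda,\tau}$ and $A_{\lambda,\mu}$ are topologically conjugate. (2) $\int_{\mathbb{R}/\mathbb{Z}}\mu=0$ and $\mu$ is not cohomologous to $0$.
   Context: For $\lambda\in(0,1)$ and a continuous function $\tau:\mathbb{R}/\mathbb{Z}\to\mathbb{R}$, let $A_{\lambda,\tau}:\mathbb{R}/\mathbb{Z}\times\mathbb{R}\to\mathbb{R}/\mathbb{Z}\times\mathbb{R}$, $A_{\lambda,\tau}(\theta,t)=(\ell\theta,\lambda t+\tau(\theta))$, and let $\Omega_{\lambda,\tau}$ be the non-wandering set of $A_{\lambda,\tau}$. $\mathcal{J}_\tau=\{\lambda\in(0,1):\Omega_{\lambda,\tau}\text{ is a Jordan curve}\}$ (Jordan curve: a set homeomorphic to the circle). With $\mathbf{m}_\ell(\theta)=\ell\theta$ on $\mathbb{R}/\mathbb{Z}$, a function $\mu:\mathbb{R}/\mathbb{Z}\to\mathbb{R}$ is cohomologous to $0$ if $\mu=\rho\circ\mathbf{m}_\ell-\rho$ for some continuous $\rho:\mathbb{R}/\mathbb{Z}\to\mathbb{R}$. Integrals are with respect to Lebesgue measure. *)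

theory Defs
  imports "HOL-Analysis.Analysis"
begin

quotient_type circle = real / "\<lambda>x y. x - y \<in> \<int>"
  morphisms rep_circle to_circle
proof (rule equivpI)
  show "reflp (\<lambda>x y. x - y \<in> (\<int>::real set))" by (simp add: reflp_def)
  show "symp (\<lambda>x y. x - y \<in> (\<int>::real set))"
    by (rule sympI) (drule Ints_minus, simp)
  show "transp (\<lambda>x y. x - y \<in> (\<int>::real set))"
    by (rule transpI) (drule (1) Ints_add, simp)
qed

lemma infdist_Ints_attained:
  obtains n where "n \<in> (\<int>::real set)" "infdist (x::real) \<int> = dist x n"
proof -
  have "(\<int>::real set) \<noteq> {}" using Ints_0 by blast
  then show ?thesis
    by (rule infdist_attains_inf[OF closed_Ints]) (rule that)
qed

lemma infdist_Ints_add: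
  assumes "(r::real) \<in> \<int>"
  shows "infdist (x + r) \<int> = infdist x \<int>"
proof -
  have *: "infdist (y + s) \<int> \<le> infdist y \<int>" if s: "s \<in> \<int>" for y s :: real
  proof -
    obtain a where a: "a \<in> (\<int>::real set)" "infdist y \<int> = dist y a"
      by (rule infdist_Ints_attained)
    have "infdist (y + s) \<int> \<le> dist (y + s) (a + s)"
      by (intro infdist_le Ints_add a s)
    then show ?thesis using a(2) by simp
  qed
  show ?thesis
    using *[OF assms, of x] *[of "- r" "x + r"] assms by simp
qed

text \<open>The quotient metric: the distance between two classes is the minimum of
  \<open>\<bar>x - y - n\<bar>\<close> over the integers \<open>n\<close>.\<close>

instantiation circle :: metric_space
begin

lift_definition dist_circle :: "circle \<Rightarrow> circle \<Rightarrow> real" is "\<lambda>x y. infdist (x - y) \<int>"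
proof -
  fix x x' y y' :: real
  assume "x - x' \<in> \<int>" "y - y' \<in> \<int>"
  then have "(x - x') - (y - y') \<in> \<int>" by (rule Ints_diff)
  then have "infdist ((x' - y') + ((x - x') - (y - y'))) \<int> = infdist (x' - y') \<int>"
    by (rule infdist_Ints_add)
  then show "infdist (x - y) \<int> = infdist (x' - y') \<int>"
    by (simp add: algebra_simps)
qed

definition uniformity_circle :: "(circle \<times> circle) filter" where
  "uniformity_circle = (INF e\<in>{0<..}. principal {(x, y). dist x y < e})"

definition open_circle :: "circle set \<Rightarrow> bool" where
  "open_circle U \<longleftrightarrow> (\<forall>x\<in>U. \<forall>\<^sub>F (x', y) in uniformity. x' = x \<longrightarrow> y \<in> U)"

instance
proof
  show "(dist a b = 0) = (a = b)" for a b :: circle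
  proof (transfer)
    fix x y :: real
    show "(infdist (x - y) \<int> = 0) = (x - y \<in> \<int>)"
      using in_closed_iff_infdist_zero[of "\<int>::real set" "x - y"]
        closed_Ints[where ?'a=real] by auto
  qed
  show "dist a b \<le> dist a c + dist b c" for a b c :: circle
  proof (transfer)
    fix x y z :: real
    obtain m where m: "m \<in> (\<int>::real set)" "infdist (x - z) \<int> = dist (x - z) m"
      by (rule infdist_Ints_attained)
    obtain n where n: "n \<in> (\<int>::real set)" "infdist (y - z) \<int> = dist (y - z) n"
      by (rule infdist_Ints_attained)
    have "infdist (x - y) \<int> \<le> dist (x - y) (m - n)"
      by (intro infdist_le Ints_diff m n)
    also have "\<dots> \<le> dist (x - z) m + dist (y - z) n"
      by (simp add: dist_real_def)
    finally show "infdist (x - y) \<int> \<le> infdist (x - z) \<int> + infdist (y - z) \<int>"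
      using m n by simp
  qed
qed (fact uniformity_circle_def open_circle_def)+

end

lemma dist_to_circle: "dist (to_circle x) (to_circle y) = infdist (x - y) \<int>"
  by transfer simp

lemma continuous_on_to_circle: "continuous_on S to_circle"
proof -
  have "1-lipschitz_on S to_circle"
  proof (rule lipschitz_onI)
    fix x y :: real
    have "infdist (x - y) \<int> \<le> dist (x - y) 0" by (rule infdist_le) simp
    then show "dist (to_circle x) (to_circle y) \<le> 1 * dist x y"
      by (simp add: dist_to_circle dist_real_def)
  qed simp
  then show ?thesis by (rule lipschitz_on_continuous_on)
qed

lemma borel_measurable_to_circle [measurable]: "to_circle \<in> borel_measurable borel"
  by (intro borel_measurable_continuous_onI continuous_on_to_circle)

definition circle_lebesgue :: "circle measure" where
  "circle_lebesgue = distr (restrict_space lborel {0..<1}) borel to_circle"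

lift_definition circle_mult :: "nat \<Rightarrow> circle \<Rightarrow> circle" is "\<lambda>l x. real l * x"
  by (simp add: right_diff_distrib[symmetric] Ints_mult)

definition skew_map ::
    "nat \<Rightarrow> real \<Rightarrow> (circle \<Rightarrow> real) \<Rightarrow> circle \<times> real \<Rightarrow> circle \<times> real" where
  "skew_map l lam \<tau> = (\<lambda>(\<theta>, t). (circle_mult l \<theta>, lam * t + \<tau> \<theta>))"

definition nonwandering_set :: "('a::topological_space \<Rightarrow> 'a) \<Rightarrow> 'a set" where
  "nonwandering_set f =
    {x. \<forall>U. open U \<longrightarrow> x \<in> U \<longrightarrow> (\<exists>n\<ge>1. (f ^^ n) ` U \<inter> U \<noteq> {})}"

definition jordan_curve :: "'a::topological_space set \<Rightarrow> bool" where
  "jordan_curve S \<longleftrightarrow> S homeomorphic (UNIV :: circle set)"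

definition jordan_params :: "nat \<Rightarrow> (circle \<Rightarrow> real) \<Rightarrow> real set" where
  "jordan_params l \<tau> = {lam \<in> {0<..<1}. jordan_curve (nonwandering_set (skew_map l lam \<tau>))}"

definition topologically_conjugate ::
    "('a::topological_space \<Rightarrow> 'a) \<Rightarrow> ('b::topological_space \<Rightarrow> 'b) \<Rightarrow> bool" where
  "topologically_conjugate f g \<longleftrightarrow>
    (\<exists>h h'. homeomorphism UNIV UNIV h h' \<and> h \<circ> f = g \<circ> h)"

definition cohomologous_to_zero :: "nat \<Rightarrow> (circle \<Rightarrow> real) \<Rightarrow> bool" where
  "cohomologous_to_zero l \<mu> \<longleftrightarrow>
    (\<exists>\<rho>. continuous_on UNIV \<rho> \<and> \<mu> = (\<lambda>\<theta>. \<rho> (circle_mult l \<theta>) - \<rho> \<theta>))"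

end

theory Submission
  imports Defs "HOL-Complex_Analysis.Complex_Analysis"
begin

text \<open>
  For \<open>0 < \<lambda> < 1\<close> the non-wandering set \<open>\<Omega>\<close> is a Jordan curve iff \<open>\<tau> = \<rho> \<circ> m - \<lambda> \<rho>\<close> for a
  continuous \<open>\<rho>\<close>: in that case \<open>\<Omega>\<close> is the graph of \<open>\<rho>\<close>; conversely \<open>\<Omega>\<close> always contains the
  immersed line \<open>x \<mapsto> (x, S x)\<close> with \<open>S x = (\<Sum>n. \<lambda> ^ n * \<tau> (x / l ^ (n + 1)))\<close>, and a Jordan curve
  can contain it only if \<open>S\<close> is 1-periodic.

  If \<open>\<tau> = \<rho> \<circ> m - \<lambda>\<^sub>0 \<rho> + c\<close> with \<open>0 < \<lambda>\<^sub>0 \<le> 1\<close>, then \<open>\<tau> = (\<lambda> - \<lambda>\<^sub>0) \<rho> + (\<rho> \<circ> m - \<lambda> \<rho>) + c\<close>, so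
  for \<open>\<lambda> \<noteq> \<lambda>\<^sub>0\<close> the skew products of \<open>\<tau>\<close> and \<open>\<rho>\<close> are conjugate, and \<open>\<tau>\<close> may be replaced by
  \<open>\<rho>\<close>, which is again Lipschitz. This can be repeated only finitely often when \<open>\<tau>\<close> is not
  constant: the increments \<open>S (x + 1) - S x\<close> form a power series \<open>F[\<tau>] (\<lambda>)\<close> with radius of
  convergence above 1, not identically zero for suitable \<open>x\<close>, and
  \<open>F[\<tau>] (z) = (z - \<lambda>\<^sub>0) F[\<rho>] (z)\<close>, so each replacement removes a zero from the closed unit disc.
  For constant \<open>\<tau>\<close> no conjugacy is required and one starts from any non-constant Lipschitz
  function instead.
\<close>

section \<open>The circle\<close>

lemma to_circle_eq_iff: "to_circle x = to_circle y \<longleftrightarrow> x - y \<in> \<int>"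
  by (metis circle.abs_eq_iff)

lemma to_circle_rep_circle: "to_circle (rep_circle \<theta>) = \<theta>"
  by (simp add: Quotient3_abs_rep[OF Quotient3_circle])

lemma circle_cases:
  obtains x where "\<theta> = to_circle x"
  using to_circle_rep_circle by metis

lemma to_circle_add_Ints: "n \<in> \<int> \<Longrightarrow> to_circle (x + n) = to_circle x"
  by (simp add: to_circle_eq_iff)

lemma circle_mult_to_circle: "circle_mult l (to_circle x) = to_circle (real l * x)"
  by (simp add: circle_mult.abs_eq)

lemma dist_to_circle_le: "dist (to_circle x) (to_circle y) \<le> \<bar>x - y\<bar>"
proof -
  have "infdist (x - y) \<int> \<le> dist (x - y) 0" by (rule infdist_le) simp
  then show ?thesis by (simp add: dist_to_circle dist_real_def)
qed

text \<open>The representative of \<open>\<theta>\<close> nearest to \<open>x\<close> turns a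
  distance on the circle into one on the line; this carries continuity and Lipschitz bounds between
  functions and their lifts.\<close>

lemma dist_circle_attained:
  obtains y where "\<theta> = to_circle y" "\<bar>x - y\<bar> = dist (to_circle x) \<theta>"
proof -
  obtain z where z: "\<theta> = to_circle z" by (rule circle_cases)
  obtain n where n: "n \<in> \<int>" "infdist (x - z) \<int> = dist (x - z) n"
    by (rule infdist_Ints_attained)
  show thesis
  proof
    show "\<theta> = to_circle (z + n)" using z to_circle_add_Ints n by simp
    show "\<bar>x - (z + n)\<bar> = dist (to_circle x) \<theta>"
      using n by (simp add: z dist_to_circle dist_real_def algebra_simps)
  qed
qed

lemma continuous_on_circleI:
  fixes f :: "circle \<Rightarrow> 'a::metric_space"
  assumes "continuous_on UNIV (\<lambda>x. f (to_circle x))"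
  shows "continuous_on UNIV f"
  unfolding continuous_on_iff
proof (intro ballI allI impI)
  fix \<theta> :: circle and e :: real assume "e > 0"
  obtain x where x: "\<theta> = to_circle x" by (rule circle_cases)
  obtain d where d: "d > 0" "\<And>y. dist y x < d \<Longrightarrow> dist (f (to_circle y)) (f (to_circle x)) < e"
    using assms \<open>e > 0\<close> unfolding continuous_on_iff by (metis UNIV_I)
  have "dist (f \<theta>') (f \<theta>) < e" if "dist \<theta>' \<theta> < d" for \<theta>'
  proof -
    obtain y where "\<theta>' = to_circle y" "\<bar>x - y\<bar> = dist (to_circle x) \<theta>'"
      by (rule dist_circle_attained)
    then show ?thesis using d that x by (metis dist_commute dist_real_def)
  qed
  then show "\<exists>d>0. \<forall>x'\<in>UNIV. dist x' \<theta> < d \<longrightarrow> dist (f x') (f \<theta>) < e"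
    using d by blast
qed

lemma continuous_on_comp_to_circle:
  assumes "continuous_on UNIV (f :: circle \<Rightarrow> 'a::topological_space)"
  shows "continuous_on S (\<lambda>x. f (to_circle x))"
  by (rule continuous_on_compose2[OF assms continuous_on_to_circle]) auto

lemma lipschitz_on_circle_iff:
  fixes f :: "circle \<Rightarrow> real"
  shows "C-lipschitz_on UNIV f \<longleftrightarrow>
    0 \<le> C \<and> (\<forall>x y. \<bar>f (to_circle x) - f (to_circle y)\<bar> \<le> C * \<bar>x - y\<bar>)"
proof safe
  assume L: "C-lipschitz_on UNIV f"
  then show C: "0 \<le> C" by (rule lipschitz_on_nonneg)
  fix x y
  have "\<bar>f (to_circle x) - f (to_circle y)\<bar> \<le> C * dist (to_circle x) (to_circle y)"
    using lipschitz_onD[OF L] by (simp add: dist_real_def)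
  also have "\<dots> \<le> C * \<bar>x - y\<bar>" by (intro mult_left_mono dist_to_circle_le C)
  finally show "\<bar>f (to_circle x) - f (to_circle y)\<bar> \<le> C * \<bar>x - y\<bar>" .
next
  assume C: "0 \<le> C" and L: "\<forall>x y. \<bar>f (to_circle x) - f (to_circle y)\<bar> \<le> C * \<bar>x - y\<bar>"
  show "C-lipschitz_on UNIV f"
  proof (rule lipschitz_onI[OF _ C])
    fix \<theta> \<theta>' :: circle
    obtain x where x: "\<theta> = to_circle x" by (rule circle_cases)
    obtain y where "\<theta>' = to_circle y" "\<bar>x - y\<bar> = dist (to_circle x) \<theta>'"
      by (rule dist_circle_attained)
    then show "dist (f \<theta>) (f \<theta>') \<le> C * dist \<theta> \<theta>'" using L x by (metis dist_real_def)
  qed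
qed

lemma continuous_circle_bounded:
  fixes f :: "circle \<Rightarrow> real"
  assumes "continuous_on UNIV f"
  obtains B where "\<And>\<theta>. \<bar>f \<theta>\<bar> \<le> B"
proof -
  have "compact ((\<lambda>x. f (to_circle x)) ` {0..1})"
    by (intro compact_continuous_image continuous_on_comp_to_circle assms compact_Icc)
  then obtain B where B: "\<And>x. x \<in> {0..1} \<Longrightarrow> \<bar>f (to_circle x)\<bar> \<le> B"
    by (fastforce dest: compact_imp_bounded simp: bounded_iff)
  have "\<bar>f \<theta>\<bar> \<le> B" for \<theta>
  proof -
    obtain x where x: "\<theta> = to_circle x" by (rule circle_cases)
    have "to_circle x = to_circle (frac x)"
      by (simp add: to_circle_eq_iff frac_def)
    then show ?thesis using B[of "frac x"] x by (simp add: frac_lt_1 less_imp_le)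
  qed
  then show thesis by (rule that)
qed

text \<open>Through \<open>cis\<close> the circle becomes the complex unit circle, and a nowhere
  vanishing continuous function on the contractible line has a continuous logarithm, whose imaginary
  part divided by \<open>2 * pi\<close> is the lift.\<close>

lemma circle_lift:
  fixes f :: "real \<Rightarrow> circle"
  assumes f: "continuous_on UNIV f"
  obtains g where "continuous_on UNIV g" "\<And>x. f x = to_circle (g x)"
proof -
  define E where "E \<theta> = cis (2 * pi * rep_circle \<theta>)" for \<theta>
  have cis_eq: "cis (2 * pi * x) = cis (2 * pi * y) \<longleftrightarrow> x - y \<in> \<int>" for x y
  proof -
    have "cis (2 * pi * x) = cis (2 * pi * y) \<longleftrightarrow> (\<exists>n::int. 2 * pi * x = 2 * pi * y + 2 * pi * of_int n)"
      using sin_cos_eq_iff[of "2 * pi * x" "2 * pi * y"] by (auto simp: complex_eq_iff)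
    also have "\<dots> \<longleftrightarrow> (\<exists>n::int. x - y = of_int n)"
      unfolding distrib_left[symmetric] mult_cancel_left by (simp add: algebra_simps)
    finally show ?thesis by (auto simp: Ints_def)
  qed
  have E: "E (to_circle x) = cis (2 * pi * x)" for x
    unfolding E_def cis_eq using to_circle_rep_circle to_circle_eq_iff by blast
  have "continuous_on UNIV E"
    by (rule continuous_on_circleI) (auto simp: E intro!: continuous_intros)
  then have "continuous_on UNIV (\<lambda>x. E (f x))"
    using f by (rule continuous_on_compose2) auto
  moreover have "contractible (UNIV :: real set)" by (intro convex_imp_contractible convex_UNIV)
  ultimately obtain L where L: "continuous_on UNIV L" "\<And>x. E (f x) = exp (L x)"
    by (rule continuous_logarithm_on_contractible) (auto simp: E_def)
  show thesis
  proof
    show "continuous_on UNIV (\<lambda>x. Im (L x) / (2 * pi))"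
      using L by (auto intro!: continuous_intros)
    fix x
    have "exp (Re (L x)) = 1"
      using arg_cong[OF L(2)[of x], of norm] by (simp add: E_def)
    then have "exp (L x) = cis (Im (L x))" by (simp add: exp_eq_polar)
    then have "cis (2 * pi * rep_circle (f x)) = cis (2 * pi * (Im (L x) / (2 * pi)))"
      using L(2)[of x] by (simp add: E_def)
    then show "f x = to_circle (Im (L x) / (2 * pi))"
      unfolding cis_eq using to_circle_rep_circle to_circle_eq_iff by metis
  qed
qed

lemma continuous_Ints_valued_constant:
  fixes f :: "real \<Rightarrow> real"
  assumes "continuous_on UNIV f" "\<And>x. f x \<in> \<int>"
  shows "f x = f y"
proof -
  have "f constant_on UNIV"
  proof (rule continuous_discrete_range_constant)
    fix x
    show "\<exists>e>0. \<forall>y. y \<in> UNIV \<and> f y \<noteq> f x \<longrightarrow> e \<le> norm (f y - f x)"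
    proof (intro exI[of _ 1] conjI allI impI)
      fix y assume "y \<in> UNIV \<and> f y \<noteq> f x"
      then show "1 \<le> norm (f y - f x)"
        using Ints_nonzero_abs_ge1[of "f y - f x"] assms(2) by auto
    qed simp
  qed (use assms in auto)
  then show ?thesis by (auto simp: constant_on_def)
qed

section \<open>Invariant graphs and twisted coboundaries\<close>

text \<open>The constant \<open>c\<close> matters only for \<open>lam = 1\<close>: it makes the notion invariant under adding
  constants to \<open>\<tau>\<close>, so that the mean can be removed at the very end.\<close>

definition twisted_coboundary :: "nat \<Rightarrow> real \<Rightarrow> (circle \<Rightarrow> real) \<Rightarrow> bool" where
  "twisted_coboundary l lam \<tau> \<longleftrightarrow>
    (\<exists>\<rho> c. continuous_on UNIV \<rho> \<and> (\<forall>\<theta>. \<tau> \<theta> = \<rho> (circle_mult l \<theta>) - lam * \<rho> \<theta> + c))"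

lemma funpow_skew_map_fst:
  "fst ((skew_map l lam \<tau> ^^ n) (to_circle x, s)) = to_circle (real l ^ n * x)"
  by (induction n) (auto simp: skew_map_def case_prod_unfold circle_mult_to_circle mult.assoc)

lemma funpow_skew_map_diff:
  "snd ((skew_map l lam \<tau> ^^ n) (\<theta>, s)) - snd ((skew_map l lam \<tau> ^^ n) (\<theta>, s'))
    = lam ^ n * (s - s')"
proof -
  obtain x where "\<theta> = to_circle x" by (rule circle_cases)
  then have eq: "fst ((skew_map l lam \<tau> ^^ n) (\<theta>, s)) = fst ((skew_map l lam \<tau> ^^ n) (\<theta>, s'))" for n
    by (simp add: funpow_skew_map_fst)
  show ?thesis
  proof (induction n)
    case (Suc n)
    have "snd ((skew_map l lam \<tau> ^^ Suc n) (\<theta>, s)) - snd ((skew_map l lam \<tau> ^^ Suc n) (\<theta>, s')) =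
      lam * (snd ((skew_map l lam \<tau> ^^ n) (\<theta>, s)) - snd ((skew_map l lam \<tau> ^^ n) (\<theta>, s')))"
      using eq[of n] by (simp add: skew_map_def[of l lam \<tau>] case_prod_unfold right_diff_distrib)
    then show ?case by (simp only: Suc power_Suc mult.assoc)
  qed simp
qed

lemma funpow_skew_map_invariant:
  fixes S :: "real \<Rightarrow> real"
  assumes "\<And>x. S (real l * x) = lam * S x + \<tau> (to_circle x)"
  shows "(skew_map l lam \<tau> ^^ n) (to_circle x, S x) = (to_circle (real l ^ n * x), S (real l ^ n * x))"
  by (induction n) (auto simp: skew_map_def circle_mult_to_circle assms mult.assoc)

text \<open>The height above an invariant curve is multiplied by \<open>lam\<close> at each step.
  Since \<open>S\<close> need not be periodic, the formula depends on the representative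
  \<open>x\<close>: several branches of the curve may lie over one point.\<close>

lemma funpow_skew_map:
  fixes S :: "real \<Rightarrow> real"
  assumes "\<And>x. S (real l * x) = lam * S x + \<tau> (to_circle x)"
  shows "(skew_map l lam \<tau> ^^ n) (to_circle x, s) =
    (to_circle (real l ^ n * x), S (real l ^ n * x) + lam ^ n * (s - S x))"
proof (rule prod_eqI)
  show "snd ((skew_map l lam \<tau> ^^ n) (to_circle x, s)) =
    snd (to_circle (real l ^ n * x), S (real l ^ n * x) + lam ^ n * (s - S x))"
    using funpow_skew_map_diff[where \<theta> = "to_circle x" and s' = "S x"]
      funpow_skew_map_invariant[of S, OF assms] by (simp add: algebra_simps)
qed (simp add: funpow_skew_map_fst)

text \<open>The witness returns to a neighbourhood of \<open>(x, S x)\<close> as follows: a point close to \<open>x\<close> is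
  expanded onto \<open>x / l ^ n\<close>, and the next \<open>n\<close> steps contract its fibre towards \<open>S x\<close>.\<close>

lemma invariant_curve_nonwandering:
  fixes S :: "real \<Rightarrow> real"
  assumes l: "l \<ge> 2" and lam: "0 < lam" "lam < 1"
    and S: "\<And>x. S (real l * x) = lam * S x + \<tau> (to_circle x)"
    and B: "\<And>x. \<bar>S x\<bar> \<le> B"
  shows "(to_circle x, S x) \<in> nonwandering_set (skew_map l lam \<tau>)"
  unfolding nonwandering_set_def
proof (intro CollectI allI impI)
  fix U assume "open U" "(to_circle x, S x) \<in> U"
  then obtain V W where VW: "open V" "to_circle x \<in> V" "open W" "S x \<in> W" "V \<times> W \<subseteq> U"
    by (rule open_prod_elim) auto
  obtain d where d: "d > 0" "\<And>\<theta>. dist \<theta> (to_circle x) < d \<Longrightarrow> \<theta> \<in> V"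
    using VW by (metis open_dist)
  obtain e where e: "e > 0" "\<And>s. dist s (S x) < e \<Longrightarrow> s \<in> W"
    using VW by (metis open_dist)
  \<comment> \<open>The height error on arrival over \<open>y\<close> is at most
    \<open>4 * B\<close>: \<open>2 * B\<close> from the branches at \<open>y + j\<close> and
    \<open>y\<close>, and \<open>2 * B\<close> from the starting height.\<close>
  have "(\<lambda>n. lam ^ n * (4 * B)) \<longlonglongrightarrow> 0 * (4 * B)"
    using lam by (intro tendsto_intros LIMSEQ_realpow_zero) auto
  then have "\<forall>\<^sub>F n in sequentially. lam ^ n * (4 * B) < e"
    using e(1) by (intro order_tendstoD(2)) auto
  then obtain n where n: "lam ^ n * (4 * B) < e"
    by (meson eventually_sequentially order_refl)
  obtain m where "(1 / d) < real l ^ m"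
    using real_arch_pow[of "real l" "1 / d"] l by auto
  then have m: "1 / real l ^ m < d" using d l by (simp add: field_simps)
  define y where "y = x / real l ^ n"
  \<comment> \<open>The integer \<open>j\<close> leaves the base point of \<open>y\<close> unchanged
    and brings \<open>x'\<close> within \<open>1 / l ^ Suc m\<close> of \<open>x\<close>. Using
    \<open>Suc m\<close> keeps the return time positive even if \<open>n = 0\<close>.\<close>
  define j :: real where "j = of_int \<lfloor>real l ^ Suc m * x - y\<rfloor>"
  define x' where "x' = (y + j) / real l ^ Suc m"
  have lx': "real l ^ Suc m * x' = y + j" using l by (simp add: x'_def)
  have ly: "real l ^ n * y = x" using l by (simp add: y_def)
  have "\<bar>real l ^ Suc m * (x - x')\<bar> \<le> 1"
    unfolding right_diff_distrib lx' j_def by linarith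
  then have "real l ^ Suc m * \<bar>x - x'\<bar> \<le> 1" by (simp add: abs_mult)
  then have "\<bar>x - x'\<bar> \<le> 1 / real l ^ Suc m" using l by (simp add: field_simps)
  also have "\<dots> \<le> 1 / real l ^ m" using l by (intro divide_left_mono power_increasing) auto
  also note m
  finally have "dist (to_circle x') (to_circle x) < d"
    using dist_to_circle_le[of x' x] by (simp add: abs_minus_commute)
  then have u: "(to_circle x', S x) \<in> U" using d VW by blast
  define t where "t = S (y + j) + lam ^ Suc m * (S x - S x')"
  have "to_circle (y + j) = to_circle y" by (simp add: j_def to_circle_add_Ints)
  then have "(skew_map l lam \<tau> ^^ Suc m) (to_circle x', S x) = (to_circle y, t)"
    unfolding funpow_skew_map[of S l lam \<tau>, OF S] lx' t_def by simp
  then have im: "(skew_map l lam \<tau> ^^ (n + Suc m)) (to_circle x', S x) = (to_circle x, S x + lam ^ n * (t - S y))"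
    unfolding funpow_add o_def by (simp add: funpow_skew_map[of S l lam \<tau>, OF S] ly del: funpow.simps)
  define w where "w = lam ^ Suc m * (S x - S x')"
  have "\<bar>w\<bar> \<le> 1 * \<bar>S x - S x'\<bar>"
    unfolding w_def abs_mult using lam by (intro mult_right_mono) (auto intro!: power_le_one mult_le_one simp: abs_mult)
  then have "\<bar>w\<bar> \<le> 2 * B" using B[of x] B[of x'] by (smt (verit))
  then have "\<bar>t - S y\<bar> \<le> 4 * B"
    using B[of y] B[of "y + j"] unfolding t_def w_def[symmetric] by linarith
  then have "\<bar>lam ^ n * (t - S y)\<bar> \<le> lam ^ n * (4 * B)"
    using lam by (simp add: abs_mult)
  then have "(to_circle x, S x + lam ^ n * (t - S y)) \<in> U"
    using n e VW by (auto simp: dist_real_def)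
  moreover have "(to_circle x, S x + lam ^ n * (t - S y)) \<in> (skew_map l lam \<tau> ^^ (n + Suc m)) ` U"
    using imageI[OF u, of "skew_map l lam \<tau> ^^ (n + Suc m)"] unfolding im .
  ultimately show "\<exists>n\<ge>1. (skew_map l lam \<tau> ^^ n) ` U \<inter> U \<noteq> {}"
    by (intro exI[of _ "n + Suc m"] conjI) (simp, meson disjoint_iff)
qed

lemma twisted_coboundary_absorb_constant:
  assumes "lam \<noteq> 1" "twisted_coboundary l lam \<tau>"
  obtains \<rho> where "continuous_on UNIV \<rho>" "\<And>\<theta>. \<tau> \<theta> = \<rho> (circle_mult l \<theta>) - lam * \<rho> \<theta>"
proof -
  obtain \<rho> c where \<rho>: "continuous_on UNIV \<rho>"
      "\<And>\<theta>. \<tau> \<theta> = \<rho> (circle_mult l \<theta>) - lam * \<rho> \<theta> + c"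
    using assms unfolding twisted_coboundary_def by blast
  \<comment> \<open>Shifting \<open>\<rho>\<close> by \<open>k\<close> changes the coboundary by
    \<open>(1 - lam) * k\<close>.\<close>
  define k where "k = c / (1 - lam)"
  have k: "k - lam * k = c" using assms(1) by (simp add: k_def divide_simps) (simp add: algebra_simps)
  show thesis
  proof
    show "continuous_on UNIV (\<lambda>\<theta>. \<rho> \<theta> + k)" by (intro continuous_intros \<rho>)
    show "\<tau> \<theta> = (\<rho> (circle_mult l \<theta>) + k) - lam * (\<rho> \<theta> + k)" for \<theta>
      using k \<rho>(2)[of \<theta>] by (simp only: distrib_left)
  qed
qed

text \<open>The distance to the graph of \<open>\<rho>\<close> along fibres scales by exactly
  \<open>lam\<close>, so no point off the graph is non-wandering; the graph itself is an invariant
  curve and projects homeomorphically to the circle.\<close>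

lemma twisted_coboundary_imp_jordan:
  assumes l: "l \<ge> 2" and lam: "0 < lam" "lam < 1" and "twisted_coboundary l lam \<tau>"
  shows "jordan_curve (nonwandering_set (skew_map l lam \<tau>))"
proof -
  obtain \<rho> where \<rho>: "continuous_on UNIV \<rho>" "\<And>\<theta>. \<tau> \<theta> = \<rho> (circle_mult l \<theta>) - lam * \<rho> \<theta>"
    using twisted_coboundary_absorb_constant assms by (metis less_irrefl)
  define v where "v p = \<bar>snd p - \<rho> (fst p)\<bar>" for p
  have v_step: "v (skew_map l lam \<tau> p) = lam * v p" for p
  proof -
    have "v (skew_map l lam \<tau> p) = \<bar>lam * (snd p - \<rho> (fst p))\<bar>"
      by (simp add: v_def skew_map_def case_prod_unfold \<rho>(2) algebra_simps)
    then show ?thesis using lam by (simp add: abs_mult v_def)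
  qed
  have v_pow: "v ((skew_map l lam \<tau> ^^ n) p) = lam ^ n * v p" for n p
    by (induction n) (auto simp: v_step)
  have cv: "continuous_on UNIV v"
    unfolding v_def
    by (intro continuous_intros continuous_on_compose2[OF \<rho>(1)]) auto
  have "(\<theta>, s) \<in> nonwandering_set (skew_map l lam \<tau>) \<longleftrightarrow> s = \<rho> \<theta>" for \<theta> s
  proof
    assume s: "s = \<rho> \<theta>"
    obtain x where x: "\<theta> = to_circle x" by (rule circle_cases)
    obtain B where "\<And>\<theta>. \<bar>\<rho> \<theta>\<bar> \<le> B" using continuous_circle_bounded[OF \<rho>(1)] by blast
    then show "(\<theta>, s) \<in> nonwandering_set (skew_map l lam \<tau>)"
      unfolding s x
      by (intro invariant_curve_nonwandering[OF l lam, where S = "\<lambda>x. \<rho> (to_circle x)"])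
        (auto simp: \<rho>(2) circle_mult_to_circle)
  next
    assume N: "(\<theta>, s) \<in> nonwandering_set (skew_map l lam \<tau>)"
    show "s = \<rho> \<theta>"
    proof (rule ccontr)
      assume "s \<noteq> \<rho> \<theta>"
      define a where "a = v (\<theta>, s)"
      have a: "a > 0" using \<open>s \<noteq> \<rho> \<theta>\<close> by (simp add: a_def v_def)
      \<comment> \<open>The bounds \<open>q * a\<close> and \<open>a / q\<close> for
        \<open>v\<close> on \<open>U\<close> have ratio \<open>lam\<close>, so every iterate with
        \<open>n \<ge> 1\<close> leaves \<open>U\<close>.\<close>
      define q where "q = sqrt lam"
      have q: "0 < q" "q < 1" "q * q = lam" using lam by (auto simp: q_def)
      define U where "U = {p. q * a < v p} \<inter> {p. v p < a / q}"
      have "open U" unfolding U_def using cv by (intro open_Int open_Collect_less) auto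
      moreover have "(\<theta>, s) \<in> U" using q a by (simp add: U_def flip: a_def) (simp add: field_simps)
      ultimately obtain n p where n: "n \<ge> 1" and p: "p \<in> U" "(skew_map l lam \<tau> ^^ n) p \<in> U"
        using N unfolding nonwandering_set_def by blast
      have "q * a < lam ^ n * v p" using p(2) by (simp add: U_def v_pow)
      also have "lam ^ n \<le> lam" using n lam power_decreasing[of 1 n lam] by simp
      then have "lam ^ n * v p \<le> lam * v p" by (intro mult_right_mono) (auto simp: v_def)
      also have "\<dots> < lam * (a / q)"
        using p(1) lam by (intro mult_strict_left_mono) (auto simp: U_def)
      also have "\<dots> = q * a" using q by (metis mult.assoc mult.commute nonzero_mult_div_cancel_left less_irrefl times_divide_eq_right)
      finally show False by simp
    qed
  qed
  then have "nonwandering_set (skew_map l lam \<tau>) = range (\<lambda>\<theta>. (\<theta>, \<rho> \<theta>))"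
    by auto
  moreover have "homeomorphism (range (\<lambda>\<theta>. (\<theta>, \<rho> \<theta>))) UNIV fst (\<lambda>\<theta>. (\<theta>, \<rho> \<theta>))"
    using \<rho>(1) by (auto simp: homeomorphism_def image_image intro!: continuous_intros)
  ultimately show ?thesis unfolding jordan_curve_def homeomorphic_def by metis
qed

section \<open>The transfer series on the line and its periodicity\<close>

text \<open>Solving \<open>S (l * x) = lam * S x + \<tau> x\<close> backwards along
  \<open>x / l ^ n\<close> leads to this series. It lives on the line because the preimages
  \<open>x / l ^ n\<close> depend on the representative.\<close>

definition transfer_series :: "nat \<Rightarrow> real \<Rightarrow> (circle \<Rightarrow> real) \<Rightarrow> real \<Rightarrow> real" where
  "transfer_series l lam \<tau> x = (\<Sum>n. lam ^ n * \<tau> (to_circle (x / real l ^ Suc n)))"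

lemma summable_transfer_series:
  fixes \<tau> :: "circle \<Rightarrow> real"
  assumes "0 < lam" "lam < 1" "\<And>\<theta>. \<bar>\<tau> \<theta>\<bar> \<le> B"
  shows "summable (\<lambda>n. lam ^ n * \<tau> (to_circle (x / real l ^ Suc n)))"
proof (rule summable_comparison_test[where g = "\<lambda>n. lam ^ n * B"])
  show "\<exists>N. \<forall>n\<ge>N. norm (lam ^ n * \<tau> (to_circle (x / real l ^ Suc n))) \<le> lam ^ n * B"
    using assms by (auto simp: abs_mult intro!: mult_left_mono)
  show "summable (\<lambda>n. lam ^ n * B)"
    using assms by (intro summable_mult2 summable_geometric) auto
qed

lemma transfer_series_bounded:
  assumes "0 < lam" "lam < 1" and B: "\<And>\<theta>. \<bar>\<tau> \<theta>\<bar> \<le> B"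
  shows "\<bar>transfer_series l lam \<tau> x\<bar> \<le> B / (1 - lam)"
proof -
  have "norm (transfer_series l lam \<tau> x) \<le> (\<Sum>n. lam ^ n * B)"
    unfolding transfer_series_def
  proof (rule norm_suminf_le)
    show "norm (lam ^ n * \<tau> (to_circle (x / real l ^ Suc n))) \<le> lam ^ n * B" for n
      using assms by (auto simp: abs_mult intro!: mult_left_mono)
    show "summable (\<lambda>n. lam ^ n * B)"
      using assms by (intro summable_mult2 summable_geometric) auto
  qed
  also have "\<dots> = B / (1 - lam)"
    using assms by (subst suminf_mult2[symmetric]) (auto intro!: summable_geometric simp: suminf_geometric)
  finally show ?thesis by simp
qed

lemma transfer_series_step:
  assumes "l \<ge> 2" "0 < lam" "lam < 1" "\<And>\<theta>. \<bar>\<tau> \<theta>\<bar> \<le> B"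
  shows "transfer_series l lam \<tau> (real l * x) = lam * transfer_series l lam \<tau> x + \<tau> (to_circle x)"
proof -
  have "transfer_series l lam \<tau> (real l * x) =
      (\<Sum>n. lam ^ Suc n * \<tau> (to_circle (real l * x / real l ^ Suc (Suc n)))) + \<tau> (to_circle x)"
    unfolding transfer_series_def
    using suminf_split_head[OF summable_transfer_series[of lam \<tau> B "real l * x" l]] assms by simp
  also have "(\<lambda>n. lam ^ Suc n * \<tau> (to_circle (real l * x / real l ^ Suc (Suc n)))) =
      (\<lambda>n. lam * (lam ^ n * \<tau> (to_circle (x / real l ^ Suc n))))"
    using assms by (simp add: mult.assoc)
  also have "suminf \<dots> = lam * transfer_series l lam \<tau> x"
    unfolding transfer_series_def
    by (intro suminf_mult summable_transfer_series[of lam \<tau> B] assms)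
  finally show ?thesis .
qed

lemma continuous_transfer_series:
  assumes "l \<ge> 2" "0 < lam" "lam < 1" "\<And>\<theta>. \<bar>\<tau> \<theta>\<bar> \<le> B" "continuous_on UNIV \<tau>"
  shows "continuous_on UNIV (transfer_series l lam \<tau>)"
proof -
  have "uniform_limit UNIV (\<lambda>n x. \<Sum>i<n. lam ^ i * \<tau> (to_circle (x / real l ^ Suc i)))
      (transfer_series l lam \<tau>) sequentially"
    unfolding transfer_series_def [abs_def]
  proof (rule Weierstrass_m_test)
    show "norm (lam ^ n * \<tau> (to_circle (x / real l ^ Suc n))) \<le> lam ^ n * B" for n x
      using assms by (auto simp: abs_mult intro!: mult_left_mono)
    show "summable (\<lambda>n. lam ^ n * B)"
      using assms by (intro summable_mult2 summable_geometric) auto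
  qed
  then show ?thesis
  proof (rule uniform_limit_theorem[rotated])
    show "\<forall>\<^sub>F n in sequentially. continuous_on UNIV (\<lambda>x. \<Sum>i<n. lam ^ i * \<tau> (to_circle (x / real l ^ Suc i)))"
      using assms(1)
      by (intro always_eventually allI continuous_intros
          continuous_on_compose2[OF continuous_on_comp_to_circle[OF assms(5)]]) auto
  qed simp
qed

text \<open>In the universal covers of \<open>K\<close> and of the base, let \<open>g\<close> lift the curve \<open>x \<mapsto> (x, S x)\<close> and
  \<open>p\<close> the projection of \<open>K\<close>. Up to a translation \<open>p\<close> is inverse to \<open>g\<close>, so both are
  homeomorphisms of the line, and \<open>K\<close> is a \<open>d\<close>-fold covering of the base with \<open>S\<close> \<open>d\<close>-periodic.
  Then \<open>S (x + 1) - S x\<close> has a zero, and injectivity of the covering forces \<open>\<bar>d\<bar> = 1\<close>.\<close>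

lemma curve_in_jordan_curve_periodic:
  fixes S :: "real \<Rightarrow> real"
  assumes K: "jordan_curve K" and S: "continuous_on UNIV S"
    and SK: "\<And>x. (to_circle x, S x) \<in> K"
  shows "S (x + 1) = S x"
proof -
  obtain h k where hom: "homeomorphism K (UNIV :: circle set) h k"
    using K unfolding jordan_curve_def homeomorphic_def by blast
  have hk: "k (h q) = q" if "q \<in> K" for q using hom that by (simp add: homeomorphism_def)
  have ch: "continuous_on K h" and ck: "continuous_on UNIV k"
    using hom by (auto simp: homeomorphism_def)
  have c\<gamma>: "continuous_on UNIV (\<lambda>x. (to_circle x, S x))"
    by (intro continuous_intros continuous_on_to_circle S)
  obtain g where g: "continuous_on UNIV g" "\<And>x. h (to_circle x, S x) = to_circle (g x)"
    using circle_lift[OF continuous_on_compose2[OF ch c\<gamma>]] SK by blast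
  obtain p where p: "continuous_on UNIV p" "\<And>u. fst (k (to_circle u)) = to_circle (p u)"
    using circle_lift[OF continuous_on_fst[OF continuous_on_comp_to_circle[OF ck]]] by blast
  have kg: "k (to_circle (g x)) = (to_circle x, S x)" for x
    using hk[OF SK[of x]] g(2) by simp
  have \<gamma>_eqI: "S x = S y" if "g x - g y \<in> \<int>" for x y
    using kg[of x] kg[of y] to_circle_eq_iff that by (metis prod.inject)
  define c where "c = p (g 0)"
  have pg: "p (g x) = x + c" for x
  proof -
    have "to_circle (p (g x)) = to_circle x" for x
      using p(2)[of "g x"] kg[of x] by simp
    then have "p (g x) - x \<in> \<int>" for x by (simp add: to_circle_eq_iff)
    then have "p (g x) - x = p (g 0) - 0"
      by (intro continuous_Ints_valued_constant continuous_intros continuous_on_compose2[OF p(1) g(1)]) auto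
    then show ?thesis by (simp add: c_def)
  qed
  have inj_g: "inj g" by (rule injI) (metis pg add_right_cancel)
  \<comment> \<open>A monotone \<open>g\<close> bounded on one side would map a half-line (selected
    by the sign \<open>s\<close>) into a compact interval, where \<open>p\<close> is bounded,
    against \<open>p (g x) = x + c\<close>.\<close>
  have unb: "\<exists>x. g x > b" and unb': "\<exists>x. g x < b" for b
  proof -
    have mono: "strict_mono g \<or> (\<forall>x y. x < y \<longrightarrow> g y < g x)"
      using injective_eq_monotone_map[of UNIV g] g(1) inj_g
      by (auto simp: is_interval_univ strict_mono_on_def monotone_on_def)
    have bd: False if I: "\<And>x. s * x \<ge> 0 \<Longrightarrow> g x \<in> {a..b}" and s: "s = 1 \<or> s = -1" for a b s
    proof -
      have "compact (p ` {a..b})"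
        by (intro compact_continuous_image continuous_on_subset[OF p(1)] compact_Icc subset_UNIV)
      then obtain B where B: "\<And>u. u \<in> {a..b} \<Longrightarrow> \<bar>p u\<bar> \<le> B"
        by (fastforce dest: compact_imp_bounded simp: bounded_iff)
      have "B \<ge> 0" using B[OF I[of 0]] by simp
      define x where "x = s * (B + \<bar>c\<bar> + 1)"
      have "s * x \<ge> 0" "\<bar>x + c\<bar> > B" using s \<open>B \<ge> 0\<close> by (auto simp: x_def)
      then show False using B[OF I[of x]] pg[of x] by simp
    qed
    show "\<exists>x. g x > b"
    proof (rule ccontr)
      assume "\<nexists>x. b < g x"
      then have le: "g x \<le> b" for x by (simp add: not_less)
      from mono show False
      proof
        assume "strict_mono g"
        then have "g x \<in> {g 0..b}" if "1 * x \<ge> 0" for x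
          using le that by (simp add: strict_mono_less_eq)
        then show False using bd by blast
      next
        assume "\<forall>x y. x < y \<longrightarrow> g y < g x"
        then have "g x \<in> {g 0..b}" if "-1 * x \<ge> 0" for x
          using le that by (cases "x = 0") (auto simp: less_imp_le)
        then show False using bd by blast
      qed
    qed
    show "\<exists>x. g x < b"
    proof (rule ccontr)
      assume "\<nexists>x. g x < b"
      then have le: "b \<le> g x" for x by (simp add: not_less)
      from mono show False
      proof
        assume "strict_mono g"
        then have "g x \<in> {b..g 0}" if "-1 * x \<ge> 0" for x
          using le that by (simp add: strict_mono_less_eq)
        then show False using bd by blast
      next
        assume "\<forall>x y. x < y \<longrightarrow> g y < g x"
        then have "g x \<in> {b..g 0}" if "1 * x \<ge> 0" for x
          using le that by (cases "x = 0") (auto simp: less_imp_le)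
        then show False using bd by blast
      qed
    qed
  qed
  have surj_g: "\<exists>x. g x = u" for u
  proof -
    obtain a b where ab: "g a < u" "u < g b" using unb unb' by blast
    have "connected (range g)" by (intro connected_continuous_image g(1) connected_UNIV)
    then have "u \<in> range g" using connectedD_interval[of "range g" "g a" "g b" u] ab by auto
    then show ?thesis by blast
  qed
  have inj_p: "u = v" if "p u = p v" for u v
    using surj_g[of u] surj_g[of v] pg that by (metis add_right_cancel)
  \<comment> \<open>\<open>d\<close> is the degree of the projection of \<open>K\<close>,
    parametrised by \<open>k\<close>, to the base circle.\<close>
  define d where "d = p 1 - p 0"
  have pd: "p (u + 1) = p u + d" and d_Ints: "d \<in> \<int>" for u
  proof -
    have *: "p (u + 1) - p u \<in> \<int>" for u
      using p(2)[of u] p(2)[of "u + 1"] by (simp add: to_circle_add_Ints flip: to_circle_eq_iff)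
    then have "p (u + 1) - p u = p (0 + 1) - p 0"
      by (intro continuous_Ints_valued_constant continuous_intros continuous_on_compose2[OF p(1)]) auto
    then show "p (u + 1) = p u + d" by (simp add: d_def)
    show "d \<in> \<int>" using *[of 0] by (simp add: d_def)
  qed
  have "d \<noteq> 0" using pd[of 0] inj_p[of "0 + 1" 0] by auto
  \<comment> \<open>Advancing \<open>x\<close> by \<open>d\<close> amounts to one full turn along
    \<open>K\<close>.\<close>
  have Sd: "S (x + d) = S x" for x
  proof -
    have "p (g x + 1) = p (g (x + d))" by (simp add: pd pg)
    then have "g x + 1 = g (x + d)" by (rule inj_p)
    then show ?thesis by (intro \<gamma>_eqI) (metis Ints_1 add_diff_cancel_left')
  qed
  define D where "D x = S (x + 1) - S x" for x
  have cD: "continuous_on UNIV D" unfolding D_def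
    by (intro continuous_intros continuous_on_compose2[OF S]) auto
  obtain d' :: int where d': "d = of_int d'" using d_Ints by (rule Ints_cases)
  define m where "m = nat \<bar>d'\<bar>"
  have m: "\<bar>d\<bar> = real m" "m > 0" using d' \<open>d \<noteq> 0\<close> by (auto simp: m_def)
  have Sm: "S (x + real m) = S x" for x
  proof (cases "d \<ge> 0")
    case False
    then have "real m = - d" using m(1) by simp
    then show ?thesis using Sd[of "x - d"] by simp
  qed (use Sd[of x] m(1) in simp)
  \<comment> \<open>The values of \<open>D\<close> at \<open>0, ..., m - 1\<close> telescope to
    \<open>S m - S 0 = 0\<close>, so \<open>D\<close> cannot have constant sign.\<close>
  have "\<exists>x. D x = 0"
  proof (rule ccontr)
    assume ne: "\<nexists>x. D x = 0"
    have sum: "(\<Sum>i<m. D (real i)) = 0"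
    proof -
      have "(\<Sum>i<n. D (real i)) = S (real n) - S 0" for n
        by (induction n) (auto simp: D_def add.commute)
      then show ?thesis using Sm[of 0] by simp
    qed
    have "connected (range D)" by (intro connected_continuous_image cD connected_UNIV)
    then have "(\<forall>x. D x > 0) \<or> (\<forall>x. D x < 0)"
    proof -
      have "\<not> (D x < 0 \<and> 0 < D y)" for x y
        using ne connectedD_interval[OF \<open>connected (range D)\<close>, of "D x" "D y" 0] by force
      then show ?thesis using ne by (meson linorder_cases)
    qed
    then show False
    proof
      assume "\<forall>x. D x > 0"
      then have "(\<Sum>i<m. D (real i)) > 0" using m by (intro sum_pos) (auto simp: lessThan_empty_iff)
      then show False using sum by simp
    next
      assume "\<forall>x. D x < 0"
      then have "(\<Sum>i<m. - D (real i)) > 0" using m by (intro sum_pos) (auto simp: lessThan_empty_iff)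
      then show False using sum by (simp add: sum_negf)
    qed
  qed
  then obtain z where z: "S (z + 1) = S z" by (auto simp: D_def)
  \<comment> \<open>The curve points at \<open>z\<close> and \<open>z + 1\<close> coincide, so
    \<open>g\<close> advances by an integer \<open>n\<close> between them; projecting gives
    \<open>1 = n * d\<close>.\<close>
  have "k (to_circle (g (z + 1))) = k (to_circle (g z))"
    using kg z by (simp add: to_circle_add_Ints)
  then have "to_circle (g (z + 1)) = to_circle (g z)"
    using hom by (metis UNIV_I homeomorphism_def)
  then have "g (z + 1) - g z \<in> \<int>" by (simp add: to_circle_eq_iff)
  then obtain n :: int where n: "g (z + 1) = g z + of_int n"
    by (metis Ints_cases add.commute diff_add_cancel)
  have pn: "p (u + of_nat n) = p u + of_nat n * d" for u n
  proof (induction n)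
    case (Suc n)
    then show ?case using pd[of "u + of_nat n"] by (simp add: algebra_simps)
  qed simp
  have "p (u + of_int n) = p u + of_int n * d" for u n
  proof (cases n)
    case (neg m)
    then have n: "of_int n = - real (Suc m)" by simp
    show ?thesis
      using pn[of "u - real (Suc m)" "Suc m"]
      unfolding n by (simp only: diff_add_cancel add_uminus_conv_diff mult_minus_left)
  qed (simp add: pn)
  then have "1 = of_int n * d" using pg[of "z + 1"] pg[of z] n by simp
  then have "of_int (n * d') = (1 :: real)" using d' by simp
  then have "n * d' = 1" by linarith
  then have "d = 1 \<or> d = -1" using d' by (auto simp: zmult_eq_1_iff)
  then show ?thesis using Sd[of x] Sd[of "x + 1"] by auto
qed

text \<open>The transfer series traces a curve inside the non-wandering set. If that set is a Jordan
  curve, the series is 1-periodic and descends to the circle as \<open>\<rho>\<close>.\<close>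

lemma jordan_imp_twisted_coboundary:
  assumes l: "l \<ge> 2" and lam: "0 < lam" "lam < 1" and \<tau>: "continuous_on UNIV \<tau>"
    and J: "jordan_curve (nonwandering_set (skew_map l lam \<tau>))"
  shows "twisted_coboundary l lam \<tau>"
proof -
  obtain B where B: "\<And>\<theta>. \<bar>\<tau> \<theta>\<bar> \<le> B" using continuous_circle_bounded[OF \<tau>] by blast
  define S where "S = transfer_series l lam \<tau>"
  have step: "S (real l * x) = lam * S x + \<tau> (to_circle x)" for x
    unfolding S_def by (rule transfer_series_step[OF l lam B])
  have cont: "continuous_on UNIV S"
    unfolding S_def by (rule continuous_transfer_series[OF l lam B \<tau>])
  have "(to_circle x, S x) \<in> nonwandering_set (skew_map l lam \<tau>)" for x
    by (rule invariant_curve_nonwandering[OF l lam])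
      (use step transfer_series_bounded[OF lam B] in \<open>auto simp: S_def\<close>)
  then have per: "S (x + 1) = S x" for x
    by (rule curve_in_jordan_curve_periodic[OF J cont])
  have "S (x + of_nat n) = S x" for x n
  proof (induction n)
    case (Suc n)
    then show ?case using per[of "x + of_nat n"] by (simp add: add_ac)
  qed simp
  note per_nat = this
  have "S (x + of_int n) = S x" for x n
  proof (cases n)
    case (neg m)
    then have "x + of_int n = x - of_nat (Suc m)" by simp
    then show ?thesis
      using per_nat[of "x - of_nat (Suc m)" "Suc m"] by (simp only: diff_add_cancel)
  qed (simp add: per_nat)
  then have S_eqI: "S x = S y" if "to_circle x = to_circle y" for x y
    using that unfolding to_circle_eq_iff by (metis Ints_cases add.commute diff_add_cancel)
  define \<rho> where "\<rho> \<theta> = S (rep_circle \<theta>)" for \<theta>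
  have \<rho>: "\<rho> (to_circle x) = S x" for x
    unfolding \<rho>_def by (intro S_eqI to_circle_rep_circle)
  have "continuous_on UNIV \<rho>" by (rule continuous_on_circleI) (simp add: \<rho> cont)
  moreover have "\<tau> \<theta> = \<rho> (circle_mult l \<theta>) - lam * \<rho> \<theta> + 0" for \<theta>
    by (rule circle_cases[of \<theta>]) (simp add: circle_mult_to_circle \<rho> step)
  ultimately show ?thesis unfolding twisted_coboundary_def by blast
qed

section \<open>Removing common zeros of the increment series\<close>

text \<open>Differences of \<open>\<rho>\<close> are pulled back along \<open>x * q ^ n\<close>: the
  errors from \<open>\<tau>\<close> form a geometric sum and the remainder tends to 0 by continuity
  at 0. The contraction comes from the base, so \<open>lam = 1\<close> is covered.\<close>

lemma twisted_coboundary_lipschitz: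
  fixes \<tau> \<rho> :: "circle \<Rightarrow> real"
  assumes l: "l \<ge> 2" and lam: "0 < lam" "lam \<le> 1" and L: "L-lipschitz_on UNIV \<tau>"
    and \<rho>: "continuous_on UNIV \<rho>" "\<And>\<theta>. \<tau> \<theta> = \<rho> (circle_mult l \<theta>) - lam * \<rho> \<theta> + c"
  shows "L-lipschitz_on UNIV \<rho>"
proof -
  define r where "r x = \<rho> (to_circle x)" for x
  define q where "q = 1 / real l"
  have q: "0 < q" "q \<le> 1 / 2" using l by (auto simp: q_def field_simps)
  have L0: "0 \<le> L" and Lt: "\<bar>\<tau> (to_circle x) - \<tau> (to_circle y)\<bar> \<le> L * \<bar>x - y\<bar>" for x y
    using L unfolding lipschitz_on_circle_iff by auto
  have rec: "r x = lam * r (x * q) + \<tau> (to_circle (x * q)) - c" for x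
    using \<rho>(2)[of "to_circle (x * q)"] l by (simp add: r_def q_def circle_mult_to_circle)
  have step: "\<bar>r x - r y\<bar> \<le> \<bar>r (x * q) - r (y * q)\<bar> + L * \<bar>x - y\<bar> * q" for x y
  proof -
    have "r x - r y = lam * (r (x * q) - r (y * q)) + (\<tau> (to_circle (x * q)) - \<tau> (to_circle (y * q)))"
      by (simp add: rec[of x] rec[of y] algebra_simps)
    then have "\<bar>r x - r y\<bar> \<le> lam * \<bar>r (x * q) - r (y * q)\<bar> + \<bar>\<tau> (to_circle (x * q)) - \<tau> (to_circle (y * q))\<bar>"
      using lam by (metis abs_mult abs_of_pos abs_triangle_ineq)
    also have "\<dots> \<le> 1 * \<bar>r (x * q) - r (y * q)\<bar> + L * \<bar>x * q - y * q\<bar>"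
      by (intro add_mono mult_right_mono Lt lam) auto
    also have "\<bar>x * q - y * q\<bar> = \<bar>x - y\<bar> * q"
      using q by (simp add: abs_mult flip: left_diff_distrib)
    finally show ?thesis by (simp add: mult.assoc)
  qed
  \<comment> \<open>\<open>1 - q ^ n\<close> bounds \<open>q + ... + q ^ n\<close> because
    \<open>q \<le> 1 / 2\<close>; this is what preserves the constant \<open>L\<close>.\<close>
  have iter: "\<bar>r x - r y\<bar> \<le> L * \<bar>x - y\<bar> * (1 - q ^ n) + \<bar>r (x * q ^ n) - r (y * q ^ n)\<bar>" for x y n
  proof (induction n)
    case (Suc n)
    have "\<bar>r (x * q ^ n) - r (y * q ^ n)\<bar> \<le>
        \<bar>r (x * q ^ Suc n) - r (y * q ^ Suc n)\<bar> + L * \<bar>x - y\<bar> * q ^ Suc n"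
      using step[of "x * q ^ n" "y * q ^ n"] q by (simp add: abs_mult mult_ac flip: left_diff_distrib)
    moreover have "L * \<bar>x - y\<bar> * q ^ Suc n \<le> L * \<bar>x - y\<bar> * (q ^ n - q ^ Suc n)"
    proof (intro mult_left_mono)
      have "q ^ n * (2 * q) \<le> q ^ n * 1" using q by (intro mult_left_mono) auto
      then show "q ^ Suc n \<le> q ^ n - q ^ Suc n" by (simp add: mult_ac)
    qed (use L0 in auto)
    ultimately show ?case using Suc unfolding right_diff_distrib by linarith
  qed simp
  have cr: "isCont r 0"
    using continuous_on_comp_to_circle[OF \<rho>(1), of UNIV] unfolding r_def[symmetric]
    by (simp add: continuous_on_eq_continuous_at)
  have q0: "(\<lambda>n. q ^ n) \<longlonglongrightarrow> 0" using q by (intro LIMSEQ_realpow_zero) auto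
  have r0: "(\<lambda>n. r (x * q ^ n)) \<longlonglongrightarrow> r 0" for x
    using isCont_tendsto_compose[OF cr tendsto_mult_right_zero[OF q0]] .
  have "\<bar>r x - r y\<bar> \<le> L * \<bar>x - y\<bar>" for x y
  proof (rule LIMSEQ_le_const)
    have "(\<lambda>n. L * \<bar>x - y\<bar> * (1 - q ^ n) + \<bar>r (x * q ^ n) - r (y * q ^ n)\<bar>)
        \<longlonglongrightarrow> L * \<bar>x - y\<bar> * (1 - 0) + \<bar>r 0 - r 0\<bar>"
      by (intro tendsto_intros q0 r0)
    then show "(\<lambda>n. L * \<bar>x - y\<bar> * (1 - q ^ n) + \<bar>r (x * q ^ n) - r (y * q ^ n)\<bar>)
        \<longlonglongrightarrow> L * \<bar>x - y\<bar>" by simp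
  qed (use iter in blast)
  then show ?thesis using L0 unfolding lipschitz_on_circle_iff r_def by blast
qed

text \<open>For \<open>0 < z < 1\<close> the series below is \<open>S (x + 1) - S x\<close> with \<open>S\<close> the transfer series at
  parameter \<open>z\<close>; for Lipschitz \<open>\<tau>\<close> it converges beyond the closed unit disc.\<close>

definition increment :: "nat \<Rightarrow> (circle \<Rightarrow> real) \<Rightarrow> real \<Rightarrow> nat \<Rightarrow> real" where
  "increment l \<tau> x n = \<tau> (to_circle ((x + 1) / real l ^ Suc n)) - \<tau> (to_circle (x / real l ^ Suc n))"

definition increment_series :: "nat \<Rightarrow> (circle \<Rightarrow> real) \<Rightarrow> real \<Rightarrow> complex \<Rightarrow> complex" where
  "increment_series l \<tau> x z = (\<Sum>n. of_real (increment l \<tau> x n) * z ^ n)"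

lemma increment_bound:
  assumes "l \<ge> 2" "L-lipschitz_on UNIV \<tau>"
  shows "\<bar>increment l \<tau> x n\<bar> \<le> L * (1 / real l) ^ n"
proof -
  have "\<bar>increment l \<tau> x n\<bar> \<le> L * \<bar>(x + 1) / real l ^ Suc n - x / real l ^ Suc n\<bar>"
    using assms(2) unfolding increment_def lipschitz_on_circle_iff by blast
  also have "\<dots> \<le> L * (1 / real l) ^ n"
  proof (intro mult_left_mono)
    have "\<bar>(x + 1) / real l ^ Suc n - x / real l ^ Suc n\<bar> = (1 / real l) ^ Suc n"
      by (simp add: power_divide flip: diff_divide_distrib)
    also have "\<dots> \<le> (1 / real l) ^ n" using assms(1) by (intro power_decreasing) auto
    finally show "\<bar>(x + 1) / real l ^ Suc n - x / real l ^ Suc n\<bar> \<le> (1 / real l) ^ n" .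
  qed (use assms(2) lipschitz_on_nonneg in auto)
  finally show ?thesis .
qed

text \<open>The coefficients are bounded by a multiple of \<open>1 / l ^ n\<close>, so radius 2
  serves every \<open>l \<ge> 2\<close> and encloses the closed unit disc.\<close>

lemma sums_increment_series:
  assumes l: "l \<ge> 2" and L: "L-lipschitz_on UNIV \<tau>" and z: "norm z < 2"
  shows "(\<lambda>n. of_real (increment l \<tau> x n) * z ^ n) sums increment_series l \<tau> x z"
  unfolding increment_series_def
proof (rule summable_sums, rule summable_comparison_test[where g = "\<lambda>n. L * (norm z / 2) ^ n"])
  have "norm (of_real (increment l \<tau> x n) * z ^ n) \<le> L * (norm z / 2) ^ n" for n
  proof -
    have "norm (of_real (increment l \<tau> x n) * z ^ n) \<le> L * (1 / real l) ^ n * norm z ^ n"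
      by (simp only: norm_mult norm_power norm_of_real)
        (intro mult_right_mono increment_bound l L zero_le_power norm_ge_zero)
    also have "\<dots> \<le> L * (1 / 2) ^ n * norm z ^ n"
      using l by (intro mult_right_mono mult_left_mono power_mono divide_left_mono lipschitz_on_nonneg[OF L]) auto
    finally show ?thesis by (simp add: power_divide)
  qed
  then show "\<exists>N. \<forall>n\<ge>N. norm (of_real (increment l \<tau> x n) * z ^ n) \<le> L * (norm z / 2) ^ n" by blast
  show "summable (\<lambda>n. L * (norm z / 2) ^ n)"
    using z by (intro summable_mult summable_geometric) auto
qed

lemma holomorphic_increment_series:
  assumes "l \<ge> 2" "L-lipschitz_on UNIV \<tau>"
  shows "increment_series l \<tau> x holomorphic_on ball 0 2"
  using sums_increment_series[OF assms] by (intro power_series_holomorphic) simp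

text \<open>Composition with \<open>circle_mult l\<close> shifts the increments by one index, which
  is multiplication by \<open>z\<close>; the constant \<open>c\<close> cancels.\<close>

lemma increment_series_coboundary:
  assumes l: "l \<ge> 2" and L: "L-lipschitz_on UNIV \<rho>" and z: "norm z < 2"
    and \<rho>: "\<And>\<theta>. \<tau> \<theta> = \<rho> (circle_mult l \<theta>) - lam * \<rho> \<theta> + c"
  shows "increment_series l \<tau> x z = (z - of_real lam) * increment_series l \<rho> x z"
proof -
  define b where "b = increment l \<rho> x"
  define G where "G = increment_series l \<rho> x z"
  have G: "(\<lambda>n. of_real (b n) * z ^ n) sums G"
    unfolding b_def G_def by (rule sums_increment_series[OF l L z])
  have a: "increment l \<tau> x n = (case n of 0 \<Rightarrow> 0 | Suc m \<Rightarrow> b m) - lam * b n" for n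
  proof (cases n)
    \<comment> \<open>The shifted sequence starts with 0 because \<open>x\<close> and
      \<open>x + 1\<close> are the same point of the circle.\<close>
    case 0
    have "real l * ((x + 1) / real l) = x + 1" "real l * (x / real l) = x" using l by simp_all
    then show ?thesis using 0
      by (simp add: increment_def \<rho> circle_mult_to_circle b_def to_circle_add_Ints right_diff_distrib)
  next
    case (Suc m)
    have "real l * (y / real l ^ Suc n) = y / real l ^ n" for y using l by simp
    then show ?thesis using Suc
      by (simp add: increment_def \<rho> circle_mult_to_circle b_def right_diff_distrib del: power_Suc)
  qed
  have "(\<lambda>n. of_real (case Suc n of 0 \<Rightarrow> 0 | Suc m \<Rightarrow> b m) * z ^ Suc n) sums (z * G)"
    using sums_mult[OF G, of z] by (simp add: mult_ac)
  then have "(\<lambda>n. of_real (case n of 0 \<Rightarrow> 0 | Suc m \<Rightarrow> b m) * z ^ n) sums (z * G)"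
    by (subst (asm) sums_Suc_iff) simp
  from sums_diff[OF this sums_mult[OF G, of "of_real lam"]]
  have "(\<lambda>n. of_real (increment l \<tau> x n) * z ^ n) sums (z * G - of_real lam * G)"
    by (simp add: a algebra_simps)
  then show ?thesis unfolding increment_series_def[of l \<tau>] G_def[symmetric]
    by (simp add: sums_iff left_diff_distrib)
qed

text \<open>If all series vanish, so do all increments, and the lift of \<open>\<tau>\<close> has
  the arbitrarily small periods \<open>1 / l ^ Suc n\<close>; a Lipschitz function with such periods
  is constant.\<close>

lemma increment_series_nonzero:
  assumes l: "l \<ge> 2" and L: "L-lipschitz_on UNIV \<tau>" and nc: "\<tau> \<theta>\<^sub>1 \<noteq> \<tau> \<theta>\<^sub>2"
  shows "\<exists>x z. norm z < 2 \<and> increment_series l \<tau> x z \<noteq> 0"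
proof (rule ccontr)
  assume "\<not> ?thesis"
  then have zero: "increment_series l \<tau> x z = 0" if "norm z < 2" for x z
    using that by blast
  have inc: "increment l \<tau> x n = 0" for x n
  proof -
    have sums: "(\<lambda>n. of_real (increment l \<tau> x n) * (z - 0) ^ n) sums increment_series l \<tau> x z"
      if "norm (z - 0) < 2" for z
      using sums_increment_series[OF l L] that by simp
    show ?thesis
    proof (rule ccontr)
      assume ne: "increment l \<tau> x n \<noteq> 0"
      \<comment> \<open>Isolation of the zero at 0 is derived from a nonzero coefficient of positive
        index; the coefficient of index 0 is the value at 0.\<close>
      have "n > 0"
        using sums[of 0] zero[of 0 x] ne by (cases n) auto
      then obtain s where "0 < s" "\<And>z. z \<in> cball 0 s - {0} \<Longrightarrow> increment_series l \<tau> x z \<noteq> 0"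
        using powser_0_nonzero[where r = 2, OF _ sums, where m = n] zero[of 0 x] ne by auto
      then have "increment_series l \<tau> x (of_real (min s 1)) \<noteq> 0" by auto
      then show False using zero[of "of_real (min s 1)" x] \<open>0 < s\<close> by simp
    qed
  qed
  define q where "q = 1 / real l"
  have q: "0 < q" "q \<le> 1 / 2" using l by (auto simp: q_def field_simps)
  define t where "t x = \<tau> (to_circle x)" for x
  have per: "t (y + q ^ Suc n) = t y" for y n
    using inc[of "y * real l ^ Suc n" n] l by (simp add: increment_def t_def q_def power_divide add_divide_distrib)
  have per': "t (y + of_nat m * q ^ Suc n) = t y" for y n m
  proof (induction m)
    case (Suc m)
    then show ?case using per[of "y + of_nat m * q ^ Suc n" n] by (simp add: algebra_simps)
  qed simp
  have L0: "0 \<le> L" and Lt: "\<bar>t x - t y\<bar> \<le> L * \<bar>x - y\<bar>" for x y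
    using L unfolding lipschitz_on_circle_iff t_def by auto
  have const: "t x = t 0" if "x \<ge> 0" for x
  proof -
    have bd: "\<bar>t x - t 0\<bar> \<le> L * q ^ Suc n" for n
    proof -
      define m where "m = nat \<lfloor>x / q ^ Suc n\<rfloor>"
      have qn: "q ^ Suc n > 0" using q by simp
      have "x / q ^ Suc n \<ge> 0" using that q by simp
      then have "\<bar>x / q ^ Suc n - real m\<bar> \<le> 1" unfolding m_def by linarith
      then have "\<bar>x / q ^ Suc n - real m\<bar> * q ^ Suc n \<le> 1 * q ^ Suc n"
        using qn by (intro mult_right_mono) auto
      also have "\<bar>x / q ^ Suc n - real m\<bar> * q ^ Suc n = \<bar>(x / q ^ Suc n - real m) * q ^ Suc n\<bar>"
        using qn by (simp only: abs_mult abs_of_pos)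
      also have "(x / q ^ Suc n - real m) * q ^ Suc n = x - (0 + real m * q ^ Suc n)"
        using q by (simp add: left_diff_distrib)
      finally have "L * \<bar>x - (0 + real m * q ^ Suc n)\<bar> \<le> L * q ^ Suc n"
        using L0 by (intro mult_left_mono) auto
      then show ?thesis using Lt[of x "0 + real m * q ^ Suc n"] unfolding per' by linarith
    qed
    have "(\<lambda>n. L * q ^ Suc n) \<longlonglongrightarrow> L * 0"
      using q by (intro tendsto_intros LIMSEQ_Suc LIMSEQ_realpow_zero) auto
    then have "\<bar>t x - t 0\<bar> \<le> L * 0"
      by (rule LIMSEQ_le_const) (use bd in blast)
    then show ?thesis by simp
  qed
  have "\<tau> \<theta> = t 0" for \<theta>
  proof -
    obtain x where "\<theta> = to_circle x" by (rule circle_cases)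
    then have "\<theta> = to_circle (frac x)" by (simp add: to_circle_eq_iff frac_def)
    then show ?thesis using const[of "frac x"] by (simp add: t_def)
  qed
  then show False using nc by metis
qed

section \<open>Zeros in the closed unit disc\<close>

text \<open>Multiplicities matter because the same linear factor may be removed repeatedly, and the
  disc is closed so that the parameter 1 is included.\<close>

definition zero_count :: "(complex \<Rightarrow> complex) \<Rightarrow> nat" where
  "zero_count F = (\<Sum>w | w \<in> cball 0 1 \<and> F w = 0. nat (zorder F w))"

text \<open>The factor raises the order at \<open>a\<close> by one and leaves the other orders
  unchanged. The value at \<open>b\<close> excludes identical vanishing, so the zeros are isolated
  and the sum is finite.\<close>

lemma zero_count_linear_factor:
  assumes F: "F holomorphic_on ball 0 r" and G: "G holomorphic_on ball 0 r" and r: "r > 1"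
    and b: "b \<in> ball 0 r" "F b \<noteq> 0"
    and FG: "\<And>z. z \<in> ball 0 r \<Longrightarrow> F z = (z - a) * G z" and a: "norm a \<le> 1"
  shows "zero_count F = Suc (zero_count G)"
proof -
  have sub: "w \<in> ball 0 r" if "w \<in> cball 0 1" for w :: complex using that r by auto
  have an: "G analytic_on {w}" if "w \<in> ball 0 r" for w
    using G that open_ball analytic_at by blast
  have evFG: "\<forall>\<^sub>F z in at w. (z - a) * G z \<noteq> 0 \<and> F z = (z - a) * G z" if "w \<in> ball 0 r" for w
    using non_zero_neighbour_alt[OF F open_ball connected_ball that b]
    by (rule eventually_mono) (use FG in auto)
  have evG: "\<forall>\<^sub>F z in at w. G z \<noteq> 0" if "w \<in> ball 0 r" for w
    using evFG[OF that] by (rule eventually_mono) simp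
  have ord: "zorder F w = (if w = a then 1 else 0) + zorder G w" if w: "w \<in> ball 0 r" for w
  proof -
    have "zorder F w = zorder (\<lambda>z. (z - a) * G z) w"
      using evFG[OF w] by (intro zorder_cong) (auto elim: eventually_mono)
    also have "\<dots> = zorder (\<lambda>z. z - a) w + zorder G w"
      using evFG[OF w] by (intro zorder_times_analytic an w analytic_intros) (auto elim: eventually_mono)
    also have "zorder (\<lambda>z. z - a) w = (if w = a then 1 else 0)"
    proof (cases "w = a")
      case True
      then show ?thesis by (auto intro!: zorder_eqI[of UNIV _ "\<lambda>_. 1"])
    next
      case False
      then show ?thesis by (auto intro!: zorder_eq_0I analytic_intros)
    qed
    finally show ?thesis .
  qed
  have ge0: "zorder G w \<ge> 0" if "w \<in> ball 0 r" for w
    using that an evG zorder_ge_0 eventually_frequently by (metis trivial_limit_at)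
  have b': "G b \<noteq> 0" using FG b by auto
  define Z where "Z = {w \<in> cball 0 1. G w = 0}"
  have finZ: "finite Z"
  proof (cases "G constant_on ball 0 r")
    case True
    then have "G w \<noteq> 0" if "w \<in> ball 0 r" for w
      using b(1) b' that unfolding constant_on_def by metis
    then have "Z = {}" using sub by (auto simp: Z_def)
    then show ?thesis by simp
  next
    case False
    then show ?thesis unfolding Z_def
      using sub by (intro holomorphic_compact_finite_zeros[OF G]) auto
  qed
  have ZF: "{w. w \<in> cball 0 1 \<and> F w = 0} = insert a Z"
    using a sub FG by (auto simp: Z_def)
  have "zero_count F = (\<Sum>w\<in>insert a Z. nat (zorder F w))"
    unfolding zero_count_def ZF ..
  also have "\<dots> = (\<Sum>w\<in>insert a Z. (if w = a then 1 else 0) + nat (zorder G w))"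
    using ord ge0 sub a by (intro sum.cong) (auto simp: Z_def nat_add_distrib)
  also have "\<dots> = 1 + (\<Sum>w\<in>insert a Z. nat (zorder G w))"
    using finZ by (simp add: sum.distrib)
  \<comment> \<open>If \<open>a\<close> is not a zero of \<open>G\<close>, its order is 0 and it
    adds nothing.\<close>
  also have "(\<Sum>w\<in>insert a Z. nat (zorder G w)) = (\<Sum>w\<in>Z. nat (zorder G w))"
  proof (cases "a \<in> Z")
    case False
    then have "zorder G a = 0" using a an sub by (intro zorder_eq_0I) (auto simp: Z_def)
    then show ?thesis using False finZ by simp
  qed (simp add: insert_absorb)
  also have "\<dots> = zero_count G" by (simp add: zero_count_def Z_def)
  finally show ?thesis by simp
qed

section \<open>Conjugacies and the descent\<close>

lemma topologically_conjugate_refl: "topologically_conjugate f f"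
  unfolding topologically_conjugate_def by (intro exI[of _ id]) (auto simp: homeomorphism_def)

lemma topologically_conjugate_trans:
  assumes "topologically_conjugate f g" "topologically_conjugate g k"
  shows "topologically_conjugate f k"
proof -
  obtain h h' where h: "homeomorphism UNIV UNIV h h'" "h \<circ> f = g \<circ> h"
    using assms(1) unfolding topologically_conjugate_def by blast
  obtain j j' where j: "homeomorphism UNIV UNIV j j'" "j \<circ> g = k \<circ> j"
    using assms(2) unfolding topologically_conjugate_def by blast
  have "homeomorphism UNIV UNIV (j \<circ> h) (h' \<circ> j')"
    by (rule homeomorphism_compose[OF h(1) j(1)])
  moreover have "(j \<circ> h) \<circ> f = k \<circ> (j \<circ> h)" using h(2) j(2) by (metis comp_assoc)
  ultimately show ?thesis unfolding topologically_conjugate_def by blast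
qed

text \<open>The conjugacy is affine on fibres,
  \<open>t \<mapsto> (t - \<sigma> \<theta> - k) / a\<close>, where \<open>k\<close> is chosen with
  \<open>(1 - lam) * k = c\<close>.\<close>

lemma skew_map_conjugateI:
  assumes \<sigma>: "continuous_on UNIV \<sigma>" and "a \<noteq> 0" "lam \<noteq> 1"
    and \<tau>: "\<And>\<theta>. \<tau> \<theta> = a * \<mu> \<theta> + \<sigma> (circle_mult l \<theta>) - lam * \<sigma> \<theta> + c"
  shows "topologically_conjugate (skew_map l lam \<tau>) (skew_map l lam \<mu>)"
proof -
  define k where "k = c / (1 - lam)"
  have k: "c = k - lam * k" using assms(3) by (simp add: k_def divide_simps) (simp add: algebra_simps)
  define h h' where "h p = (fst p, (snd p - \<sigma> (fst p) - k) / a)"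
    and "h' p = (fst p, a * snd p + \<sigma> (fst p) + k)" for p :: "circle \<times> real"
  have \<sigma>': "continuous_on UNIV (\<lambda>p :: circle \<times> real. \<sigma> (fst p))"
    by (rule continuous_on_compose2[OF \<sigma>]) (auto intro!: continuous_intros)
  have inv: "h' (h p) = p" "h (h' p) = p" for p
    using \<open>a \<noteq> 0\<close> by (simp_all add: h_def h'_def prod_eq_iff)
  have "homeomorphism UNIV UNIV h h'"
  proof (rule homeomorphismI)
    show "continuous_on UNIV h" "continuous_on UNIV h'"
      unfolding h_def h'_def using \<open>a \<noteq> 0\<close> by (auto intro!: continuous_intros \<sigma>')
  qed (auto simp: inv)
  moreover have "h \<circ> skew_map l lam \<tau> = skew_map l lam \<mu> \<circ> h"
    using \<open>a \<noteq> 0\<close>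
    by (auto simp: fun_eq_iff h_def skew_map_def \<tau> k divide_simps) (simp add: algebra_simps)
  ultimately show ?thesis unfolding topologically_conjugate_def by blast
qed

text \<open>Induction on the number of zeros. The pair \<open>x\<close>, \<open>z\<close> stays
  fixed: by the factorisation, a nonzero value for \<open>\<tau>\<close> forces one for
  \<open>\<rho>\<close>.\<close>

lemma irreducible_representative:
  assumes l: "l \<ge> 2" and "\<exists>L. L-lipschitz_on UNIV \<tau>"
    and "norm z < 2" "increment_series l \<tau> x z \<noteq> 0"
  shows "\<exists>\<mu>. (\<exists>L. L-lipschitz_on UNIV \<mu>) \<and> (\<forall>lam\<in>{0<..1}. \<not> twisted_coboundary l lam \<mu>) \<and>
    (\<forall>lam\<in>{0<..<1}. \<not> twisted_coboundary l lam \<tau> \<longrightarrow>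
      topologically_conjugate (skew_map l lam \<tau>) (skew_map l lam \<mu>))"
  using assms(2-)
proof (induction "zero_count (increment_series l \<tau> x)" arbitrary: \<tau> rule: less_induct)
  case less
  obtain L where L: "L-lipschitz_on UNIV \<tau>" using less.prems by blast
  show ?case
  proof (cases "\<exists>lam0\<in>{0<..1}. twisted_coboundary l lam0 \<tau>")
    case False
    then show ?thesis using L topologically_conjugate_refl by blast
  next
    case True
    then obtain lam0 \<rho> c where lam0: "0 < lam0" "lam0 \<le> 1" and \<rho>: "continuous_on UNIV \<rho>"
        "\<And>\<theta>. \<tau> \<theta> = \<rho> (circle_mult l \<theta>) - lam0 * \<rho> \<theta> + c"
      unfolding twisted_coboundary_def by auto
    have L\<rho>: "L-lipschitz_on UNIV \<rho>"
      by (rule twisted_coboundary_lipschitz[OF l lam0 L \<rho>])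
    have factor: "increment_series l \<tau> x w = (w - of_real lam0) * increment_series l \<rho> x w"
      if "norm w < 2" for w
      by (rule increment_series_coboundary[OF l L\<rho> that \<rho>(2)])
    have "zero_count (increment_series l \<tau> x) = Suc (zero_count (increment_series l \<rho> x))"
      using holomorphic_increment_series[OF l] L L\<rho> less.prems lam0
      by (intro zero_count_linear_factor[where r = 2 and b = z and a = "of_real lam0"] factor) auto
    moreover have "increment_series l \<rho> x z \<noteq> 0"
      using less.prems factor[of z] by auto
    ultimately obtain \<mu> where \<mu>: "\<exists>L. L-lipschitz_on UNIV \<mu>"
        "\<forall>lam\<in>{0<..1}. \<not> twisted_coboundary l lam \<mu>"
        "\<forall>lam\<in>{0<..<1}. \<not> twisted_coboundary l lam \<rho> \<longrightarrow>
          topologically_conjugate (skew_map l lam \<rho>) (skew_map l lam \<mu>)"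
      using less.hyps[of \<rho>] less.prems L\<rho> by auto
    have "topologically_conjugate (skew_map l lam \<tau>) (skew_map l lam \<mu>)"
      if lam: "lam \<in> {0<..<1}" "\<not> twisted_coboundary l lam \<tau>" for lam
    proof -
      have \<tau>: "\<tau> \<theta> = (lam - lam0) * \<rho> \<theta> + \<rho> (circle_mult l \<theta>) - lam * \<rho> \<theta> + c" for \<theta>
        by (simp add: \<rho>(2) algebra_simps)
      have "lam \<noteq> lam0" using lam(2) \<rho> unfolding twisted_coboundary_def by blast
      then have "topologically_conjugate (skew_map l lam \<tau>) (skew_map l lam \<rho>)"
        using lam by (intro skew_map_conjugateI[OF \<rho>(1) _ _ \<tau>]) auto
      \<comment> \<open>The induction hypothesis gives a conjugacy only at such \<open>lam\<close>.
        A solution \<open>\<rho>'\<close> for \<open>\<rho>\<close> would yield the solution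
        \<open>(lam - lam0) * \<rho>' + \<rho>\<close> for \<open>\<tau>\<close>.\<close>
      moreover have "\<not> twisted_coboundary l lam \<rho>"
      proof
        assume "twisted_coboundary l lam \<rho>"
        then obtain \<rho>' c' where \<rho>': "continuous_on UNIV \<rho>'"
            "\<And>\<theta>. \<rho> \<theta> = \<rho>' (circle_mult l \<theta>) - lam * \<rho>' \<theta> + c'"
          unfolding twisted_coboundary_def by blast
        have "twisted_coboundary l lam \<tau>"
          unfolding twisted_coboundary_def
        proof (intro exI conjI allI)
          show "continuous_on UNIV (\<lambda>\<theta>. (lam - lam0) * \<rho>' \<theta> + \<rho> \<theta>)"
            by (intro continuous_intros \<rho> \<rho>')
          show "\<tau> \<theta> = ((lam - lam0) * \<rho>' (circle_mult l \<theta>) + \<rho> (circle_mult l \<theta>))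
              - lam * ((lam - lam0) * \<rho>' \<theta> + \<rho> \<theta>) + ((lam - lam0) * c' + c)" for \<theta>
          proof -
            have "(lam - lam0) * \<rho> \<theta> = (lam - lam0) * \<rho>' (circle_mult l \<theta>) - lam * ((lam - lam0) * \<rho>' \<theta>) + (lam - lam0) * c'"
              by (subst \<rho>'(2)) (simp add: algebra_simps)
            then show ?thesis unfolding \<tau> distrib_left by (simp only: algebra_simps)
          qed
        qed
        then show False using lam by blast
      qed
      ultimately show ?thesis using \<mu>(3) lam topologically_conjugate_trans by blast
    qed
    then show ?thesis using \<mu> by blast
  qed
qed

section \<open>Normalising the mean and assembly\<close>

lemma emeasure_space_circle_lebesgue: "emeasure circle_lebesgue (space circle_lebesgue) = 1"
proof -
  have "to_circle \<in> restrict_space lborel {0..<1} \<rightarrow>\<^sub>M borel"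
    by (intro measurable_restrict_space1) simp
  then show ?thesis
    by (simp add: circle_lebesgue_def emeasure_distr emeasure_restrict_space space_restrict_space)
qed

lemma sets_circle_lebesgue [measurable_cong]: "sets circle_lebesgue = sets borel"
  by (simp add: circle_lebesgue_def)

theorem theorem3:
  fixes l :: nat and \<tau> :: "circle \<Rightarrow> real"
  assumes "l \<ge> 2"
    and "\<exists>C. C-lipschitz_on UNIV \<tau>"
  shows "\<exists>\<mu> :: circle \<Rightarrow> real.
    (\<exists>C. C-lipschitz_on UNIV \<mu>) \<and>
    (jordan_params l \<mu> = {} \<and>
      (\<forall>lam \<in> {0<..<1} - jordan_params l \<tau>.
        topologically_conjugate (skew_map l lam \<tau>) (skew_map l lam \<mu>))) \<and>
    ((\<integral>\<theta>. \<mu> \<theta> \<partial>circle_lebesgue) = 0 \<and> \<not> cohomologous_to_zero l \<mu>)"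
proof -
  note l = assms(1)
  have tc: "\<not> twisted_coboundary l lam \<tau>" "lam \<in> {0<..<1}"
    if "lam \<in> {0<..<1} - jordan_params l \<tau>" for lam
    using that twisted_coboundary_imp_jordan[OF l, of lam \<tau>] by (auto simp: jordan_params_def)
  have "\<exists>\<mu>. (\<exists>L. L-lipschitz_on UNIV \<mu>) \<and> (\<forall>lam\<in>{0<..1}. \<not> twisted_coboundary l lam \<mu>) \<and>
    (\<forall>lam\<in>{0<..<1}. \<not> twisted_coboundary l lam \<tau> \<longrightarrow>
      topologically_conjugate (skew_map l lam \<tau>) (skew_map l lam \<mu>))"
  proof (cases "\<exists>\<theta>\<^sub>1 \<theta>\<^sub>2. \<tau> \<theta>\<^sub>1 \<noteq> \<tau> \<theta>\<^sub>2")
    case True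
    then show ?thesis
      using irreducible_representative[OF l assms(2)] increment_series_nonzero[OF l] assms(2) by metis
  next
    case False
    \<comment> \<open>A constant is a twisted coboundary at every \<open>lam\<close>, so the
      conjugacy requirement is empty and the descent may start from the distance to a point.\<close>
    then have "\<tau> \<theta> = \<tau> (to_circle 0)" for \<theta> by blast
    then have "twisted_coboundary l lam \<tau>" for lam
      unfolding twisted_coboundary_def
      by (intro exI[of _ "\<lambda>_. 0"] exI[of _ "\<tau> (to_circle 0)"]) auto
    moreover define \<delta> where "\<delta> \<theta> = dist \<theta> (to_circle 0)" for \<theta>
    have L: "1-lipschitz_on UNIV \<delta>"
      by (rule lipschitz_onI)
        (simp_all add: \<delta>_def dist_real_def, metis abs_dist_diff_le dist_commute)
    moreover have "\<delta> (to_circle (1 / 2)) \<noteq> \<delta> (to_circle 0)"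
      by (simp add: \<delta>_def to_circle_eq_iff)
    ultimately show ?thesis
      using irreducible_representative[OF l, of \<delta>] increment_series_nonzero[OF l L] by metis
  qed
  then obtain \<nu> C where C: "C-lipschitz_on UNIV \<nu>"
    and \<nu>: "\<And>lam. lam \<in> {0<..1} \<Longrightarrow> \<not> twisted_coboundary l lam \<nu>"
    and conj: "\<And>lam. lam \<in> {0<..<1} \<Longrightarrow> \<not> twisted_coboundary l lam \<tau> \<Longrightarrow>
      topologically_conjugate (skew_map l lam \<tau>) (skew_map l lam \<nu>)"
    by blast
  define I where "I = (\<integral>\<theta>. \<nu> \<theta> \<partial>circle_lebesgue)"
  \<comment> \<open>Total mass 1 makes the new mean zero; the constant in
    \<open>twisted_coboundary\<close> absorbs \<open>I\<close> also at
    \<open>lam = 1\<close>.\<close>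
  define \<mu> where "\<mu> \<theta> = \<nu> \<theta> - I" for \<theta>
  have cont: "continuous_on UNIV \<nu>" using C by (rule lipschitz_on_continuous_on)
  have tc\<mu>: "\<not> twisted_coboundary l lam \<mu>" if "lam \<in> {0<..1}" for lam
  proof
    assume "twisted_coboundary l lam \<mu>"
    then obtain \<rho> c where "continuous_on UNIV \<rho>" "\<And>\<theta>. \<mu> \<theta> = \<rho> (circle_mult l \<theta>) - lam * \<rho> \<theta> + c"
      unfolding twisted_coboundary_def by blast
    then have "\<nu> \<theta> = \<rho> (circle_mult l \<theta>) - lam * \<rho> \<theta> + (c + I)" for \<theta>
      by (simp add: \<mu>_def diff_eq_eq)
    then show False using \<nu>[OF that] \<open>continuous_on UNIV \<rho>\<close> unfolding twisted_coboundary_def by blast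
  qed
  show ?thesis
  proof (intro exI[of _ \<mu>] conjI ballI)
    show "\<exists>C. C-lipschitz_on UNIV \<mu>"
      using C unfolding \<mu>_def lipschitz_on_def by (auto simp: dist_real_def)
    show "jordan_params l \<mu> = {}"
      using jordan_imp_twisted_coboundary[OF l, of _ \<mu>] tc\<mu> cont
      by (force simp: jordan_params_def \<mu>_def intro!: continuous_intros)
    show "\<not> cohomologous_to_zero l \<mu>"
    proof
      assume "cohomologous_to_zero l \<mu>"
      then obtain \<rho> where "continuous_on UNIV \<rho>" "\<mu> = (\<lambda>\<theta>. \<rho> (circle_mult l \<theta>) - \<rho> \<theta>)"
        unfolding cohomologous_to_zero_def by blast
      \<comment> \<open>Ordinary coboundaries are the case \<open>lam = 1\<close>, which is why the
        descent includes this endpoint.\<close>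
      then have "twisted_coboundary l 1 \<mu>"
        unfolding twisted_coboundary_def by (intro exI[of _ \<rho>] exI[of _ 0]) auto
      then show False using tc\<mu>[of 1] by simp
    qed
    interpret finite_measure circle_lebesgue
      by (rule finite_measureI) (simp add: emeasure_space_circle_lebesgue)
    obtain B where "\<And>\<theta>. \<bar>\<nu> \<theta>\<bar> \<le> B" using continuous_circle_bounded[OF cont] by blast
    moreover have "\<nu> \<in> borel_measurable circle_lebesgue"
      using borel_measurable_continuous_onI[OF cont] by (simp cong: measurable_cong_sets add: sets_circle_lebesgue)
    ultimately have "integrable circle_lebesgue \<nu>"
      by (intro integrable_const_bound[of _ B]) auto
    then show "(\<integral>\<theta>. \<mu> \<theta> \<partial>circle_lebesgue) = 0"
      by (simp add: \<mu>_def I_def measure_def emeasure_space_circle_lebesgue)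
    fix lam assume lam: "lam \<in> {0<..<1} - jordan_params l \<tau>"
    have "topologically_conjugate (skew_map l lam \<nu>) (skew_map l lam \<mu>)"
      using lam by (intro skew_map_conjugateI[where \<sigma> = "\<lambda>_. 0" and a = 1 and c = I]) (auto simp: \<mu>_def)
    then show "topologically_conjugate (skew_map l lam \<tau>) (skew_map l lam \<mu>)"
      using conj[OF tc(2,1)[OF lam]] topologically_conjugate_trans by blast
  qed
qed

end
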